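(* For a finite multigraph $G=(V,E)$, $$\omega_G(1)=\big|\{\mathbf D:\ \mathbf D\text{ is a matching of }G^{(2)}\text{ with }[\mathbf D]\supset V_O\}\big|.$$
   Context: Loops count $2$ towards degrees. $f_0=1,f_1=0,f_{n+1}(x)=xf_n(x)+f_{n-1}(x)$; $\theta_G(\beta,\gamma)=\sum_{s\subset E}\beta^{|s|}\prod_{i\in V}f_{d_i(s)}(\gamma)$, $d_i(s)$ the degree of $i$ in $(V,s)$; $\omega_G(\beta)=\theta_G(\beta,2\sqrt{-1})/(1-\beta)^{|E|-|V|}$, a polynomial in $\beta$. $G^{(2)}$ is obtained from $G$ by inserting one new vertex in the middle of every edge (a loop at $v$ becomes two parallel edges between $v$ and the new vertex); $V_O=V$ denotes its original vertices. A matching is a set of edges no two sharing a vertex; $[\mathbf D]$ is the set of vertices covered by $\mathbf D$. *)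

theory Defs
  imports
    Complex_Main
    "HOL-Library.Multiset"
    "HOL-Computational_Algebra.Computational_Algebra"
begin

section \<open>Finite multigraphs\<close>

text \<open>
  An edge carries the multiset of its two endpoints, so parallel edges are allowed and a loop
  at \<open>v\<close> is an edge whose multiset of endpoints is \<open>{#v, v#}\<close>.
\<close>

record ('v, 'e) multigraph =
  verts :: "'v set"
  edges :: "'e set"
  ends :: "'e \<Rightarrow> 'v multiset"

locale fin_multigraph =
  fixes G :: "('v, 'e) multigraph"
  assumes finite_verts: "finite (verts G)"
    and finite_edges: "finite (edges G)"
    and size_ends: "e \<in> edges G \<Longrightarrow> size (ends G e) = 2"
    and ends_in_verts: "e \<in> edges G \<Longrightarrow> set_mset (ends G e) \<subseteq> verts G"

definition degree_in :: "('v, 'e) multigraph \<Rightarrow> 'e set \<Rightarrow> 'v \<Rightarrow> nat" where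
  "degree_in G s v = (\<Sum>e\<in>s. count (ends G e) v)"

text \<open>
  The subdivision \<open>G\<^sup>(\<^sup>2\<^sup>)\<close>: \<open>Inl v\<close> is an original vertex, \<open>Inr e\<close> the new vertex in the middle
  of \<open>e\<close>. There is one edge \<open>(e, v, k)\<close> joining \<open>v\<close> to the middle of \<open>e\<close> for each
  occurrence \<open>k\<close> of \<open>v\<close> among the two endpoints of \<open>e\<close>; so a loop at \<open>v\<close> yields the two
  parallel edges \<open>(e, v, 0)\<close> and \<open>(e, v, 1)\<close>.
\<close>

definition subdivision :: "('v, 'e) multigraph \<Rightarrow> ('v + 'e, 'e \<times> 'v \<times> nat) multigraph" where
  "subdivision G = \<lparr>
     verts = Inl ` verts G \<union> Inr ` edges G,
     edges = {(e, v, k). e \<in> edges G \<and> k < count (ends G e) v},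
     ends = (\<lambda>(e, v, k). {#Inl v, Inr e#}) \<rparr>"

definition matching :: "('v, 'e) multigraph \<Rightarrow> 'e set \<Rightarrow> bool" where
  "matching G D \<longleftrightarrow> D \<subseteq> edges G \<and>
     (\<forall>e\<in>D. \<forall>e'\<in>D. e \<noteq> e' \<longrightarrow> set_mset (ends G e) \<inter> set_mset (ends G e') = {})"

definition covered :: "('v, 'e) multigraph \<Rightarrow> 'e set \<Rightarrow> 'v set" where
  "covered G D = (\<Union>e\<in>D. set_mset (ends G e))"

lemma fin_multigraph_subdivision:
  assumes "fin_multigraph G"
  shows "fin_multigraph (subdivision G)"
proof -
  interpret fin_multigraph G by fact
  have "count (ends G e) v \<le> 2" if "e \<in> edges G" for e v
    using size_ends[OF that] by (metis count_le_size)
  moreover have v: "v \<in> verts G" if "e \<in> edges G" "k < count (ends G e) v" for e v k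
    using ends_in_verts[OF that(1)] that(2) by (metis count_greater_zero_iff gr_zeroI not_less_zero subsetD)
  ultimately have "edges (subdivision G) \<subseteq> edges G \<times> verts G \<times> {..<2}"
    by (force simp: subdivision_def intro: less_le_trans)
  then have "finite (edges (subdivision G))"
    by (rule finite_subset) (simp add: finite_verts finite_edges)
  then show ?thesis
    by unfold_locales (auto simp: subdivision_def finite_verts finite_edges intro!: imageI dest: v)
qed


section \<open>The polynomials\<close>

fun f_poly :: "nat \<Rightarrow> 'a::comm_ring_1 \<Rightarrow> 'a" where
  "f_poly 0 x = 1"
| "f_poly (Suc 0) x = 0"
| "f_poly (Suc (Suc n)) x = x * f_poly (Suc n) x + f_poly n x"

definition theta :: "('v, 'e) multigraph \<Rightarrow> 'a::comm_ring_1 \<Rightarrow> 'a \<Rightarrow> 'a" where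
  "theta G \<beta> \<gamma> =
     (\<Sum>s\<in>Pow (edges G). \<beta> ^ card s * (\<Prod>i\<in>verts G. f_poly (degree_in G s i) \<gamma>))"

text \<open>
  In the following, \<open>[:0, 1:]\<close> is the indeterminate \<open>\<beta>\<close>. The quotient is formed in the field of
  rational functions, because the exponent \<open>|E| - |V|\<close> may have either sign;
  \<open>to_fract_omega\<close> below shows that it is a polynomial, so that the description of
  \<open>omega\<close> is a proper one.
\<close>

definition omega_fract :: "('v, 'e) multigraph \<Rightarrow> complex poly fract" where
  "omega_fract G = to_fract (theta G [:0, 1:] [:2 * \<i>:])
     / to_fract (1 - [:0, 1:]) powi (int (card (edges G)) - int (card (verts G)))"

definition omega :: "('v, 'e) multigraph \<Rightarrow> complex poly" where
  "omega G = (THE p. to_fract p = omega_fract G)"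

lemma f_poly_imaginary:
  fixes c :: "'a::comm_ring_1"
  assumes "c * c = - 1"
  shows "f_poly n (2 * c) = c ^ n * (1 - of_nat n)"
proof (induction n "2 * c" rule: f_poly.induct)
  case (3 n)
  have "f_poly (Suc (Suc n)) (2 * c) = 2 * c * (c ^ Suc n * (1 - of_nat (Suc n))) + c ^ n * (1 - of_nat n)"
    using 3 by simp
  also have "\<dots> = 2 * (c * c) * c ^ n * (1 - of_nat (Suc n)) + c ^ n * (1 - of_nat n)"
    by (simp add: algebra_simps)
  also have "\<dots> = (c * c) * c ^ n * (1 - of_nat (Suc (Suc n)))"
    unfolding assms by (simp add: algebra_simps)
  finally show ?case by (simp add: mult.assoc)
qed auto

lemma sum_Pow_split_element:
  fixes g :: "'e set \<Rightarrow> 'a::comm_ring_1"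
  assumes "finite E" "e \<in> E"
  shows "(\<Sum>s\<in>Pow E. if e \<in> s then g s else 0) = (\<Sum>s\<in>Pow (E - {e}). g (insert e s))"
proof -
  have "(\<Sum>s\<in>Pow E. if e \<in> s then g s else 0) = sum g {s \<in> Pow E. e \<in> s}"
    using assms by (intro sum.inter_filter[symmetric]) simp
  also have "\<dots> = (\<Sum>s\<in>Pow (E - {e}). g (insert e s))"
    by (rule sum.reindex_bij_witness[of _ "insert e" "\<lambda>s. s - {e}"])
      (use assms in \<open>auto simp: insert_absorb\<close>)
  finally show ?thesis .
qed

lemma power_dvd_sum_Pow:
  fixes x :: "'a::comm_ring_1"
  assumes "finite W" "finite E"
  shows "(1 + x) ^ (card E - card W) dvd
    (\<Sum>s\<in>Pow E. x ^ card s * (\<Prod>v\<in>W. a v + (\<Sum>e\<in>s. c v e)))"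
  using assms
proof (induction W arbitrary: E a rule: finite_induct)
  case empty
  have "(\<Sum>s\<in>Pow E. x ^ card s) = (1 + x) ^ card E"
    using prod_add[OF empty, of "\<lambda>_. x" "\<lambda>_. 1"] by (simp add: add.commute)
  then show ?case by simp
next
  case (insert w W)
  define P where "P a s = (\<Prod>v\<in>W. a v + (\<Sum>e\<in>s. c v e))" for a s
  have step: "(\<Sum>s\<in>Pow E. x ^ card s * (\<Prod>v\<in>insert w W. a v + (\<Sum>e\<in>s. c v e)))
     = a w * (\<Sum>s\<in>Pow E. x ^ card s * P a s)
       + (\<Sum>e\<in>E. c w e * x * (\<Sum>s\<in>Pow (E - {e}). x ^ card s * P (\<lambda>v. a v + c v e) s))"
    (is "?L = ?A + ?B")
  proof -
    have "?L = (\<Sum>s\<in>Pow E. x ^ card s * ((a w + (\<Sum>e\<in>s. c w e)) * P a s))"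
      using insert.hyps by (simp add: P_def)
    also have "\<dots> = ?A + (\<Sum>s\<in>Pow E. \<Sum>e\<in>s. c w e * (x ^ card s * P a s))"
      by (simp add: algebra_simps sum.distrib sum_distrib_left sum_distrib_right)
    also have "(\<Sum>s\<in>Pow E. \<Sum>e\<in>s. c w e * (x ^ card s * P a s))
        = (\<Sum>s\<in>Pow E. \<Sum>e\<in>E. if e \<in> s then c w e * (x ^ card s * P a s) else 0)"
      by (intro sum.cong refl sum.mono_neutral_cong_left) (use insert.prems in auto)
    also have "\<dots> = (\<Sum>e\<in>E. \<Sum>s\<in>Pow E. if e \<in> s then c w e * (x ^ card s * P a s) else 0)"
      by (rule sum.swap)
    also have "\<dots> = (\<Sum>e\<in>E. \<Sum>s\<in>Pow (E - {e}). c w e * (x ^ card (insert e s) * P a (insert e s)))"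
      using insert.prems by (intro sum.cong refl sum_Pow_split_element)
    also have "\<dots> = ?B"
    proof (intro sum.cong refl, unfold sum_distrib_left, intro sum.cong refl)
      fix e s assume "e \<in> E" "s \<in> Pow (E - {e})"
      then have "finite s" "e \<notin> s"
        using insert.prems by (auto intro: finite_subset)
      then show "c w e * (x ^ card (insert e s) * P a (insert e s))
          = c w e * x * (x ^ card s * P (\<lambda>v. a v + c v e) s)"
        by (simp add: P_def mult_ac add_ac)
    qed
    finally show ?thesis .
  qed
  have "(1 + x) ^ (card E - card (insert w W)) dvd (\<Sum>s\<in>Pow E. x ^ card s * P a s)"
    unfolding P_def using insert
    by (intro dvd_trans[OF le_imp_power_dvd insert.IH]) auto
  moreover have "(1 + x) ^ (card E - card (insert w W)) dvd
      (\<Sum>s\<in>Pow (E - {e}). x ^ card s * P (\<lambda>v. a v + c v e) s)" if "e \<in> E" for e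
    unfolding P_def using insert that
    by (intro dvd_trans[OF le_imp_power_dvd insert.IH]) auto
  ultimately show ?case
    unfolding step by (intro dvd_add[OF dvd_mult dvd_sum[OF dvd_mult]])
qed

context fin_multigraph
begin

lemma sum_degree_in:
  assumes "s \<subseteq> edges G"
  shows "(\<Sum>v\<in>verts G. degree_in G s v) = 2 * card s"
proof -
  have "(\<Sum>v\<in>verts G. degree_in G s v) = (\<Sum>e\<in>s. \<Sum>v\<in>verts G. count (ends G e) v)"
    unfolding degree_in_def by (rule sum.swap)
  also have "\<dots> = (\<Sum>e\<in>s. 2)"
  proof (intro sum.cong refl)
    fix e assume "e \<in> s"
    then have e: "e \<in> edges G" using assms by auto
    have "(\<Sum>v\<in>verts G. count (ends G e) v) = size (ends G e)"
      unfolding size_multiset_overloaded_eq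
      by (rule sum.mono_neutral_right)
        (use ends_in_verts[OF e] finite_verts in \<open>auto simp: not_in_iff\<close>)
    then show "(\<Sum>v\<in>verts G. count (ends G e) v) = 2"
      using size_ends[OF e] by simp
  qed
  finally show ?thesis by simp
qed

lemma theta_imaginary:
  fixes c :: "'a::comm_ring_1"
  assumes "c * c = - 1"
  shows "theta G \<beta> (2 * c) = (\<Sum>s\<in>Pow (edges G).
    (- \<beta>) ^ card s * (\<Prod>v\<in>verts G. 1 + (\<Sum>e\<in>s. - of_nat (count (ends G e) v))))"
  unfolding theta_def
proof (intro sum.cong refl)
  fix s assume "s \<in> Pow (edges G)"
  then have s: "(\<Prod>v\<in>verts G. c ^ degree_in G s v) = (- 1) ^ card s"
    by (simp flip: power_sum add: sum_degree_in power_mult power2_eq_square assms)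
  have f: "f_poly n (2 * c) = c ^ n * (1 - of_nat n)" for n
    by (rule f_poly_imaginary[OF assms])
  show "\<beta> ^ card s * (\<Prod>v\<in>verts G. f_poly (degree_in G s v) (2 * c))
      = (- \<beta>) ^ card s * (\<Prod>v\<in>verts G. 1 + (\<Sum>e\<in>s. - of_nat (count (ends G e) v)))"
    unfolding f prod.distrib s
    by (simp add: degree_in_def sum_negf power_minus[of \<beta>])
qed

lemma power_dvd_theta:
  "(1 - [:0, 1:]) ^ (card (edges G) - card (verts G)) dvd theta G [:0, 1:] [:2 * \<i>:]"
proof -
  have c: "[:\<i>:] * [:\<i>:] = - 1"
    by (simp add: one_pCons)
  have "[:2 * \<i>:] = 2 * [:\<i>:]"
    by (simp add: numeral_poly)
  then show ?thesis
    using power_dvd_sum_Pow[OF finite_verts finite_edges, of "- [:0, 1:]" "\<lambda>_. 1"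
        "\<lambda>v e. - of_nat (count (ends G e) v)"]
    by (simp only: theta_imaginary[OF c] diff_conv_add_uminus)
qed

lemma to_fract_omega: "to_fract (omega G) = omega_fract G"
proof -
  let ?b = "1 - [:0, 1:] :: complex poly" and ?t = "theta G [:0, 1:] [:2 * \<i>:] :: complex poly"
  let ?m = "card (edges G)" and ?n = "card (verts G)"
  have b: "?b \<noteq> 0"
    by (simp add: one_pCons)
  have to_fract_power: "to_fract (p ^ k) = to_fract p ^ k" for p :: "complex poly" and k
    by (induction k) (simp_all add: to_fract_mult)
  have "\<exists>p. to_fract p = omega_fract G"
  proof (cases "?n \<le> ?m")
    case True
    obtain p where p: "?t = ?b ^ (?m - ?n) * p"
      using power_dvd_theta by (auto elim: dvdE)
    have "to_fract ?b powi (int ?m - int ?n) = to_fract (?b ^ (?m - ?n))"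
      using True by (simp add: to_fract_power power_int_of_nat flip: of_nat_diff)
    then have "omega_fract G = to_fract p"
      unfolding omega_fract_def p using b by (simp add: to_fract_mult)
    then show ?thesis by metis
  next
    case False
    then have "int ?m - int ?n = - int (?n - ?m)"
      by simp
    then have "to_fract ?b powi (int ?m - int ?n) = inverse (to_fract (?b ^ (?n - ?m)))"
      by (simp only: power_int_minus power_int_of_nat to_fract_power)
    then have "omega_fract G = to_fract (?t * ?b ^ (?n - ?m))"
      unfolding omega_fract_def by (simp add: to_fract_mult divide_inverse)
    then show ?thesis by metis
  qed
  then have "\<exists>!p. to_fract p = omega_fract G"
    by (metis to_fract_eq_iff)
  then show ?thesis
    unfolding omega_def by (rule theI')
qed

end

end

theory Submission
  imports Defs "HOL-Library.FuncSet"
begin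

text \<open>
  At \<open>\<gamma> = 2 \<i>\<close> the factor at a vertex \<open>v\<close> of \<open>\<theta>\<close> is, up to a power of \<open>\<i>\<close>, one minus the
  number of edges of \<open>G\<^sup>(\<^sup>2\<^sup>)\<close> that join \<open>v\<close> to the middle of an edge in \<open>s\<close>. Expanding the product
  over the vertices gives a sum over the choices \<open>h\<close> of one such edge for every \<open>v\<close> in a subset
  \<open>W\<close> of \<open>V\<close>. If the chosen edges lie on the set \<open>T\<close> of edges of \<open>G\<close>, then summing over \<open>s \<supseteq> T\<close>
  gives \<open>\<plusminus> \<beta>\<^bsup>|T|\<^esup> (1 - \<beta>)\<^bsup>|E| - |T|\<^esup>\<close>. After division by \<open>(1 - \<beta>)\<^bsup>|E| - |V|\<^esup>\<close> only the terms with
  \<open>|T| = |V|\<close> survive at \<open>\<beta> = 1\<close>. They have \<open>W = V\<close> and \<open>h\<close> injective into the middle vertices,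
  so they are the matchings covering \<open>V\<close>, and the signs cancel.
\<close>

text \<open>The elements are kept as full triples, the edges of \<open>subdivision G\<close> at
  \<open>Inl v\<close>, so that the image of a choice function is itself a set of edges of the
  subdivision. A loop at \<open>v\<close> contributes two of them.\<close>

definition half_edges :: "('v, 'e) multigraph \<Rightarrow> 'v \<Rightarrow> ('e \<times> 'v \<times> nat) set" where
  "half_edges G v = {(e, w, k). e \<in> edges G \<and> w = v \<and> k < count (ends G e) v}"

lemma half_edges_eq:
  "half_edges G v = (\<lambda>(e, k). (e, v, k)) ` (SIGMA e : edges G. {..<count (ends G e) v})"
  by (auto simp: half_edges_def)

text \<open>A superset of \<open>T\<close> is \<open>T\<close> together with an arbitrary subset of
  \<open>E - T\<close>; the binomial theorem sums over the latter.\<close>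

lemma sum_power_card_supersets:
  fixes x :: "'a::comm_ring_1"
  assumes "finite E" "T \<subseteq> E"
  shows "(\<Sum>s\<in>Pow E. if T \<subseteq> s then x ^ card s else 0) = x ^ card T * (1 + x) ^ (card E - card T)"
proof -
  have fin: "finite T" "finite (E - T)"
    using assms by (auto intro: finite_subset)
  have "(\<Sum>s\<in>Pow E. if T \<subseteq> s then x ^ card s else 0) = (\<Sum>s | s \<in> Pow E \<and> T \<subseteq> s. x ^ card s)"
    using assms by (intro sum.inter_filter[symmetric]) simp
  also have "\<dots> = (\<Sum>s\<in>Pow (E - T). x ^ card T * x ^ card s)"
  proof (rule sum.reindex_bij_witness[of _ "\<lambda>s. T \<union> s" "\<lambda>s. s - T"])
    fix s assume s: "s \<in> {s \<in> Pow E. T \<subseteq> s}"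
    then have "finite s"
      using assms by (auto intro: finite_subset)
    then show "x ^ card T * x ^ card (s - T) = x ^ card s"
      using s fin by (simp add: card_Diff_subset card_mono flip: power_add)
  qed (use assms in auto)
  also have "\<dots> = x ^ card T * (1 + x) ^ card (E - T)"
    using prod_add[OF fin(2), of "\<lambda>_. x" "\<lambda>_. 1"] by (simp add: sum_distrib_left add.commute)
  finally show ?thesis
    using assms fin by (simp add: card_Diff_subset)
qed

context fin_multigraph
begin

lemma finite_half_edges: "finite (half_edges G v)"
  unfolding half_edges_eq by (intro finite_imageI finite_SigmaI finite_edges) auto

lemma sum_half_edges:
  "(\<Sum>h\<in>half_edges G v. g (fst h)) = (\<Sum>e\<in>edges G. of_nat (count (ends G e) v) * (g e :: 'a::comm_ring_1))"
proof -
  have inj: "inj_on (\<lambda>(e, k). (e, v, k)) A" for A :: "('e \<times> nat) set"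
    by (auto simp: inj_on_def)
  have "(\<Sum>h\<in>half_edges G v. g (fst h)) = (\<Sum>(e, k)\<in>(SIGMA e : edges G. {..<count (ends G e) v}). g e)"
    unfolding half_edges_eq by (subst sum.reindex[OF inj]) (simp add: case_prod_unfold)
  then show ?thesis
    by (simp add: finite_edges flip: sum.Sigma)
qed

text \<open>Counts become numbers of half-edges, and distributivity selects one half-edge per
  vertex. The \<open>if\<close> keeps the range of \<open>h\<close> independent of \<open>s\<close>,
  so that the sums over \<open>s\<close> and \<open>h\<close> can later be swapped.\<close>

lemma prod_minus_count:
  assumes "W \<subseteq> verts G" "s \<subseteq> edges G"
  shows "(\<Prod>v\<in>W. \<Sum>e\<in>s. - of_nat (count (ends G e) v)) =
    (\<Sum>h\<in>PiE W (half_edges G). if fst ` h ` W \<subseteq> s then (- 1) ^ card W else (0::'a::comm_ring_1))"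
proof -
  have W: "finite W"
    using assms finite_verts by (auto intro: finite_subset)
  have "(\<Sum>e\<in>s. - of_nat (count (ends G e) v)) =
      (\<Sum>y\<in>half_edges G v. if fst y \<in> s then - 1 else (0::'a))" for v
    by (subst sum_half_edges[of "\<lambda>e. if e \<in> s then - 1 else 0"])
      (rule sum.mono_neutral_cong_left, use assms finite_edges in auto)
  then have "(\<Prod>v\<in>W. \<Sum>e\<in>s. - of_nat (count (ends G e) v)) =
      (\<Prod>v\<in>W. \<Sum>y\<in>half_edges G v. if fst y \<in> s then - 1 else (0::'a))"
    by simp
  also have "\<dots> = (\<Sum>h\<in>PiE W (half_edges G). \<Prod>v\<in>W. if fst (h v) \<in> s then - 1 else 0)"
    by (rule prod_sum_PiE[OF W finite_half_edges])
  also have "\<dots> = (\<Sum>h\<in>PiE W (half_edges G). if fst ` h ` W \<subseteq> s then (- 1) ^ card W else 0)"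
  proof (intro sum.cong refl)
    fix h :: "'v \<Rightarrow> 'e \<times> 'v \<times> nat"
    show "(\<Prod>v\<in>W. if fst (h v) \<in> s then - 1 else 0) =
        (if fst ` h ` W \<subseteq> s then (- 1) ^ card W else (0::'a))"
    proof (cases "fst ` h ` W \<subseteq> s")
      case True
      then have "(\<Prod>v\<in>W. if fst (h v) \<in> s then - 1 else 0) = (\<Prod>v\<in>W. - 1 :: 'a)"
        by (intro prod.cong) auto
      with True show ?thesis by simp
    next
      case False
      then show ?thesis
        using W by (auto intro!: prod_zero)
    qed
  qed
  finally show ?thesis .
qed

lemma theta_imaginary_half_edges:
  fixes c :: "'a::comm_ring_1"
  assumes "c * c = - 1"
  shows "theta G \<beta> (2 * c) = (\<Sum>W\<in>Pow (verts G). \<Sum>h\<in>PiE W (half_edges G).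
    (- 1) ^ card W * ((- \<beta>) ^ card (fst ` h ` W) * (1 - \<beta>) ^ (card (edges G) - card (fst ` h ` W))))"
proof -
  let ?E = "edges G" and ?V = "verts G" and ?H = "\<lambda>W. PiE W (half_edges G)"
  have "theta G \<beta> (2 * c) = (\<Sum>s\<in>Pow ?E. \<Sum>W\<in>Pow ?V. \<Sum>h\<in>?H W.
      (- 1) ^ card W * (if fst ` h ` W \<subseteq> s then (- \<beta>) ^ card s else 0))"
    unfolding theta_imaginary[OF assms]
  proof (intro sum.cong refl)
    fix s assume s: "s \<in> Pow ?E"
    have "(\<Prod>v\<in>?V. 1 + (\<Sum>e\<in>s. - of_nat (count (ends G e) v))) =
        (\<Sum>W\<in>Pow ?V. \<Prod>v\<in>W. \<Sum>e\<in>s. - of_nat (count (ends G e) v) :: 'a)"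
      using prod_add[OF finite_verts, of "\<lambda>v. \<Sum>e\<in>s. - of_nat (count (ends G e) v) :: 'a" "\<lambda>_. 1"]
      by (simp add: add.commute)
    also have "\<dots> = (\<Sum>W\<in>Pow ?V. \<Sum>h\<in>?H W. if fst ` h ` W \<subseteq> s then (- 1) ^ card W else 0)"
      using s by (intro sum.cong refl prod_minus_count) auto
    finally show "(- \<beta>) ^ card s * (\<Prod>v\<in>?V. 1 + (\<Sum>e\<in>s. - of_nat (count (ends G e) v))) =
        (\<Sum>W\<in>Pow ?V. \<Sum>h\<in>?H W. (- 1) ^ card W * (if fst ` h ` W \<subseteq> s then (- \<beta>) ^ card s else 0))"
      by (auto simp: sum_distrib_left mult.commute intro!: sum.cong)
  qed
  \<comment> \<open>With \<open>W\<close> and \<open>h\<close> fixed, the sum over \<open>s\<close>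
    becomes a sum over the supersets of the set of edges on which \<open>h\<close> lies.\<close>
  also have "\<dots> = (\<Sum>W\<in>Pow ?V. \<Sum>h\<in>?H W. (- 1) ^ card W *
      (\<Sum>s\<in>Pow ?E. if fst ` h ` W \<subseteq> s then (- \<beta>) ^ card s else 0))"
    by (subst sum.swap, intro sum.cong refl, subst sum.swap) (simp add: sum_distrib_left)
  also have "\<dots> = (\<Sum>W\<in>Pow ?V. \<Sum>h\<in>?H W.
      (- 1) ^ card W * ((- \<beta>) ^ card (fst ` h ` W) * (1 - \<beta>) ^ (card ?E - card (fst ` h ` W))))"
  proof (intro sum.cong refl)
    fix W h assume "h \<in> ?H W"
    then have "fst ` h ` W \<subseteq> ?E"
      by (force simp: half_edges_def PiE_iff)
    then show "(- 1) ^ card W * (\<Sum>s\<in>Pow ?E. if fst ` h ` W \<subseteq> s then (- \<beta>) ^ card s else 0) =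
        (- 1) ^ card W * ((- \<beta>) ^ card (fst ` h ` W) * (1 - \<beta>) ^ (card ?E - card (fst ` h ` W)))"
      by (simp add: sum_power_card_supersets finite_edges)
  qed
  finally show ?thesis .
qed

text \<open>Division by the power of 1 - \<beta> acts termwise and changes the exponent |E| - |T| to
  |V| - |T|. The latter is never truncated, because |T| is at most |W| and hence at most
  |V|.\<close>

lemma omega_half_edges:
  "omega G = (\<Sum>W\<in>Pow (verts G). \<Sum>h\<in>PiE W (half_edges G).
    (- 1) ^ card W * ((- [:0, 1:]) ^ card (fst ` h ` W) *
      (1 - [:0, 1:]) ^ (card (verts G) - card (fst ` h ` W))))" (is "_ = ?p")
proof -
  let ?b = "1 - [:0, 1:] :: complex poly" and ?t = "theta G [:0, 1:] [:2 * \<i>:] :: complex poly"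
  let ?m = "card (edges G)" and ?n = "card (verts G)"
  have c: "[:\<i>:] * [:\<i>:] = - 1" and c2: "[:2 * \<i>:] = 2 * [:\<i>:]"
    by (simp_all add: one_pCons numeral_poly)
  have left_comm: "a * (s * (x * b)) = a' * (s * (x * b'))" if "a * b = a' * b'" for a b a' b' s x :: "complex poly"
    using that by (simp add: mult.left_commute[of a] mult.left_commute[of a'])
  \<comment> \<open>Cross-multiplied form of the claim, which stays among polynomials whatever the
    sign of |E| - |V|.\<close>
  have "?b ^ ?n * ?t = ?b ^ ?m * ?p"
    unfolding c2 theta_imaginary_half_edges[OF c] sum_distrib_left
  proof (intro sum.cong refl)
    fix W h assume W: "W \<in> Pow (verts G)" and h: "h \<in> PiE W (half_edges G)"
    let ?k = "card (fst ` h ` W)"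
    have "fst ` h ` W \<subseteq> edges G"
      using h by (force simp: half_edges_def PiE_iff)
    then have m: "?k \<le> ?m"
      by (rule card_mono[OF finite_edges])
    have "finite W" "card W \<le> ?n"
      using W finite_verts by (auto intro: finite_subset card_mono)
    moreover from this have "?k \<le> card W"
      unfolding image_image by (intro card_image_le)
    ultimately have "?n + (?m - ?k) = ?m + (?n - ?k)"
      using m by simp
    then have "?b ^ ?n * ?b ^ (?m - ?k) = ?b ^ ?m * ?b ^ (?n - ?k)"
      by (simp flip: power_add)
    then show "?b ^ ?n * ((- 1) ^ card W * ((- [:0, 1:]) ^ ?k * ?b ^ (?m - ?k))) =
        ?b ^ ?m * ((- 1) ^ card W * ((- [:0, 1:]) ^ ?k * ?b ^ (?n - ?k)))"
      by (rule left_comm)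
  qed
  then have eq: "to_fract (?b ^ ?n) * to_fract ?t = to_fract (?b ^ ?m) * to_fract ?p"
    by (simp only: flip: to_fract_mult)
  have b: "to_fract ?b \<noteq> 0"
    by (simp add: one_pCons)
  have to_fract_power: "to_fract (p ^ k) = to_fract p ^ k" for p :: "complex poly" and k
    by (induction k) simp_all
  \<comment> \<open>As 1 - \<beta> is nonzero, its integer power splits into a quotient of natural
    powers.\<close>
  have "omega_fract G = to_fract ?t * to_fract ?b ^ ?n / to_fract ?b ^ ?m"
    unfolding omega_fract_def power_int_diff[OF disjI1[OF b]] power_int_of_nat by simp
  also have "\<dots> = to_fract ?p"
    using eq b by (simp add: to_fract_power field_simps)
  finally have "to_fract (omega G) = to_fract ?p"
    unfolding to_fract_omega .
  then show ?thesis
    unfolding to_fract_eq_iff .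
qed

lemma poly_omega_1:
  "poly (omega G) 1 =
    of_nat (card {h \<in> PiE (verts G) (half_edges G). inj_on (\<lambda>v. fst (h v)) (verts G)})"
proof -
  let ?V = "verts G" and ?H = "\<lambda>W. PiE W (half_edges G)"
  \<comment> \<open>The summand at \<beta> = 1. Since \<open>0 ^ 0 = 1\<close>, the last factor is
    the indicator of |T| = |V|.\<close>
  define F :: "'v set \<Rightarrow> ('v \<Rightarrow> 'e \<times> 'v \<times> nat) \<Rightarrow> complex" where
    "F W h = (- 1) ^ card W * ((- 1) ^ card (fst ` h ` W) * 0 ^ (card ?V - card (fst ` h ` W)))" for W h
  have fin: "finite (?H ?V)"
    by (intro finite_PiE finite_verts finite_half_edges)
  have "poly (omega G) 1 = (\<Sum>W\<in>Pow ?V. \<Sum>h\<in>?H W. F W h)"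
    unfolding omega_half_edges F_def by (simp add: poly_sum)
  also have "\<dots> = (\<Sum>W\<in>{?V}. \<Sum>h\<in>?H W. F W h)"
  proof (rule sum.mono_neutral_right)
    show "\<forall>W\<in>Pow ?V - {?V}. (\<Sum>h\<in>?H W. F W h) = 0"
    proof (intro ballI sum.neutral)
      fix W and h :: "'v \<Rightarrow> 'e \<times> 'v \<times> nat" assume "W \<in> Pow ?V - {?V}"
      then have "W \<subset> ?V" by auto
      then have "finite W" "card W < card ?V"
        using finite_verts by (auto intro: finite_subset psubset_card_mono)
      moreover from this have "card (fst ` h ` W) \<le> card W"
        unfolding image_image by (intro card_image_le)
      ultimately show "F W h = 0"
        by (simp add: F_def)
    qed
  qed (use finite_verts in auto)
  also have "\<dots> = (\<Sum>h\<in>?H ?V. if inj_on (\<lambda>v. fst (h v)) ?V then 1 else 0)"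
  proof -
    have "F ?V h = (if inj_on (\<lambda>v. fst (h v)) ?V then 1 else 0)" for h
    proof (cases "card (fst ` h ` ?V) = card ?V")
      case True
      \<comment> \<open>Both signs are now \<open>(- 1) ^ card ?V\<close>, so their product is
        1.\<close>
      then have "F ?V h = 1"
        by (simp add: F_def flip: power_mult_distrib)
      with True show ?thesis
        by (simp add: image_image inj_on_iff_eq_card[OF finite_verts])
    next
      case False
      moreover have "card (fst ` h ` ?V) \<le> card ?V"
        unfolding image_image by (intro card_image_le finite_verts)
      ultimately have "F ?V h = 0"
        by (simp add: F_def)
      with False show ?thesis
        by (simp add: image_image inj_on_iff_eq_card[OF finite_verts])
    qed
    then show ?thesis by simp
  qed
  also have "\<dots> = of_nat (card {h \<in> ?H ?V. inj_on (\<lambda>v. fst (h v)) ?V})"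
    using fin by (simp flip: sum.inter_filter)
  finally show ?thesis .
qed

text \<open>Every edge of the subdivision has exactly one original end, so a matching covering these
  vertices amounts to a choice of one half-edge at each. Disjointness at the middle vertices is the
  injectivity condition.\<close>

lemma bij_betw_covering_matchings:
  "bij_betw (\<lambda>h. h ` verts G)
    {h \<in> PiE (verts G) (half_edges G). inj_on (\<lambda>v. fst (h v)) (verts G)}
    {D. matching (subdivision G) D \<and> Inl ` verts G \<subseteq> covered (subdivision G) D}"
  (is "bij_betw ?f ?A ?B")
proof -
  let ?V = "verts G"
  have edges: "edges (subdivision G) = {y. fst (snd y) \<in> ?V \<and> y \<in> half_edges G (fst (snd y))}"
    using ends_in_verts by (fastforce simp: subdivision_def half_edges_def simp flip: count_greater_zero_iff)
  have ends: "set_mset (ends (subdivision G) y) = {Inl (fst (snd y)), Inr (fst y)}" for y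
    by (cases y) (simp add: subdivision_def)
  \<comment> \<open>A chosen half-edge records its original vertex, so \<open>h\<close> can be
    recovered from its image.\<close>
  have mid: "fst (snd (h v)) = v" if "h \<in> PiE ?V (half_edges G)" "v \<in> ?V" for h v
    using that by (force simp: half_edges_def PiE_iff)
  have "inj_on ?f ?A"
  proof (rule inj_onI, rule PiE_ext)
    fix h h' v assume h: "h \<in> ?A" "h' \<in> ?A" "?f h = ?f h'"
    then show "h \<in> PiE ?V (half_edges G)" "h' \<in> PiE ?V (half_edges G)" by auto
    assume v: "v \<in> ?V"
    then have "h v \<in> ?f h'"
      using h(3) by (metis imageI)
    then obtain w where "w \<in> ?V" "h v = h' w" by auto
    then show "h v = h' v"
      using mid[of h v] mid[of h' w] h v by auto
  qed
  moreover have "?f h \<in> ?B" if h: "h \<in> ?A" for h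
  proof -
    have "?f h \<subseteq> edges (subdivision G)"
      using h mid[of h] unfolding edges by (auto simp: PiE_iff)
    moreover have "set_mset (ends (subdivision G) (h v)) \<inter> set_mset (ends (subdivision G) (h w)) = {}"
      if "v \<in> ?V" "w \<in> ?V" "h v \<noteq> h w" for v w
      using that h mid[of h] unfolding ends by (auto dest: inj_onD)
    moreover have "Inl v \<in> covered (subdivision G) (?f h)" if "v \<in> ?V" for v
      using that h mid[of h v] unfolding covered_def ends by force
    ultimately show ?thesis
      unfolding matching_def by auto
  qed
  moreover have "D \<in> ?f ` ?A" if D: "D \<in> ?B" for D
  proof -
    have "\<exists>y\<in>D. fst (snd y) = v" if "v \<in> ?V" for v
      using that D unfolding covered_def ends by auto
    then obtain g where g: "g v \<in> D" "fst (snd (g v)) = v" if "v \<in> ?V" for v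
      by metis
    have sub: "D \<subseteq> edges (subdivision G)"
      using D by (auto simp: matching_def)
    have eq: "y = z" if "y \<in> D" "z \<in> D" "fst y = fst z \<or> fst (snd y) = fst (snd z)" for y z
      using that D unfolding matching_def ends by blast
    have "restrict g ?V \<in> PiE ?V (half_edges G)"
      using g sub unfolding edges by fastforce
    moreover have "inj_on (\<lambda>v. fst (restrict g ?V v)) ?V"
      using g eq by (intro inj_onI) (metis restrict_apply')
    moreover have "D = ?f (restrict g ?V)"
    proof
      \<comment> \<open>An edge of \<open>D\<close> shares its original end with the edge that
        \<open>g\<close> chose there, so the two coincide.\<close>
      show "D \<subseteq> ?f (restrict g ?V)"
      proof
        fix y assume y: "y \<in> D"
        then have v: "fst (snd y) \<in> ?V"
          using sub unfolding edges by auto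
        then have "y = g (fst (snd y))"
          using y g eq by metis
        with v show "y \<in> ?f (restrict g ?V)" by auto
      qed
    qed (use g in auto)
    ultimately show ?thesis by blast
  qed
  ultimately show ?thesis
    unfolding bij_betw_def by blast
qed

end

theorem theorem7p19:
  fixes G :: "('v, 'e) multigraph"
  assumes "fin_multigraph G"
  shows "poly (omega G) 1 =
    of_nat (card {D. matching (subdivision G) D \<and> Inl ` verts G \<subseteq> covered (subdivision G) D})"
proof -
  interpret fin_multigraph G by fact
  show ?thesis
    unfolding poly_omega_1 bij_betw_same_card[OF bij_betw_covering_matchings] ..
qed

end
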